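(* Let $A$ be a C*-algebra and let $\alpha\colon G\to \mathrm{Aut}(A)$ be an action of a finite group $G$ on $A$. If $\alpha$ has the multiplier Rokhlin property then $\alpha$ has the Rokhlin property.
   Context: Let $\mathrm M(\alpha)$ denote the extension of $\alpha$ to the multiplier algebra $\mathrm M(A)$. Multiplier Rokhlin property: for every finite set $F\subset A$ and every $\epsilon>0$ there are mutually orthogonal projections $(p_g)_{g\in G}\subset \mathrm M(A)$ such that $\|\mathrm M(\alpha)_g(p_h)-p_{gh}\|<\epsilon$ for all $g,h\in G$; $\|p_g a-ap_g\|<\epsilon$ for all $g\in G$ and $a\in F$; and $\sum_{g\in G} p_g=1_{\mathrm M(A)}$. Rokhlin property: for any $\epsilon>0$ and any finite subset $F\subset A$ there exist mutually orthogonal positive contractions $(r_g)_{g\in G}\subset A$ such that (i) $\|\alpha_g(r_h)-r_{gh}\|<\epsilon$ for all $g,h\in G$; (ii) $\|r_ga-ar_g\|<\epsilon$ for all $a\in F$ and $g\in G$; (iii) $\|(\sum_{g\in G} r_g)a-a\|<\epsilon$ for all $a\in F$. *)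

theory Defs
  imports "HOL-Analysis.Analysis" "HOL-Algebra.Group"
begin

section \<open>C*-algebras\<close>

text \<open>Not necessarily unital, and the zero algebra is allowed.\<close>

class cstar_algebra = real_normed_algebra + banach +
  fixes scaleC :: "complex \<Rightarrow> 'a \<Rightarrow> 'a" (infixr \<open>*\<^sub>C\<close> 75)
    and star :: "'a \<Rightarrow> 'a"
  assumes scaleC_add_right: "z *\<^sub>C (x + y) = z *\<^sub>C x + z *\<^sub>C y"
    and scaleC_add_left: "(z + w) *\<^sub>C x = z *\<^sub>C x + w *\<^sub>C x"
    and scaleC_scaleC: "z *\<^sub>C w *\<^sub>C x = (z * w) *\<^sub>C x"
    and scaleC_of_real: "complex_of_real r *\<^sub>C x = r *\<^sub>R x"
    and norm_scaleC: "norm (z *\<^sub>C x) = cmod z * norm x"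
    and scaleC_mult_left: "(z *\<^sub>C x) * y = z *\<^sub>C (x * y)"
    and scaleC_mult_right: "x * (z *\<^sub>C y) = z *\<^sub>C (x * y)"
    and star_add: "star (x + y) = star x + star y"
    and star_scaleC: "star (z *\<^sub>C x) = cnj z *\<^sub>C star x"
    and star_mult: "star (x * y) = star y * star x"
    and star_star: "star (star x) = x"
    and cstar_identity: "norm (star x * x) = (norm x)\<^sup>2"

definition is_projection :: "'a::cstar_algebra \<Rightarrow> bool" where
  "is_projection p \<longleftrightarrow> p * p = p \<and> star p = p"

definition is_positive :: "'a::cstar_algebra \<Rightarrow> bool" where
  "is_positive x \<longleftrightarrow> (\<exists>y. x = star y * y)"

definition star_automorphism :: "('a::cstar_algebra \<Rightarrow> 'a) \<Rightarrow> bool" where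
  "star_automorphism \<phi> \<longleftrightarrow> bij \<phi> \<and>
     (\<forall>x y. \<phi> (x + y) = \<phi> x + \<phi> y) \<and> (\<forall>z x. \<phi> (z *\<^sub>C x) = z *\<^sub>C \<phi> x) \<and>
     (\<forall>x y. \<phi> (x * y) = \<phi> x * \<phi> y) \<and> (\<forall>x. \<phi> (star x) = star (\<phi> x))"

definition Aut :: "('a::cstar_algebra \<Rightarrow> 'a) monoid" where
  "Aut = \<lparr>carrier = {\<phi>. star_automorphism \<phi>}, mult = (\<circ>), one = id\<rparr>"

lemma scaleC_one [simp]: "1 *\<^sub>C x = (x::'a::cstar_algebra)"
  using scaleC_of_real[of 1 x] by simp

lemma star_zero [simp]: "star 0 = (0::'a::cstar_algebra)"
  using star_add[of 0 0] by simp

lemma star_minus: "star (- x) = - star (x::'a::cstar_algebra)"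
  using star_add[of x "- x"] by (simp add: add_eq_0_iff)

lemma star_scaleR: "star (r *\<^sub>R x) = r *\<^sub>R star (x::'a::cstar_algebra)"
  by (metis scaleC_of_real star_scaleC complex_cnj_complex_of_real)

lemma norm_star [simp]: "norm (star x) = norm (x::'a::cstar_algebra)"
proof -
  have le: "norm y \<le> norm (star y)" for y :: 'a
  proof (cases "y = 0")
    case False
    have "norm y * norm y \<le> norm (star y) * norm y"
      using norm_mult_ineq[of "star y" y] by (simp add: cstar_identity power2_eq_square)
    with False show ?thesis by simp
  qed simp
  from le[of x] le[of "star x"] show ?thesis by (simp add: star_star)
qed

lemma star_automorphism_inv:
  assumes "star_automorphism \<phi>"
  shows "star_automorphism (inv_into UNIV \<phi>)"
proof -
  have b: "bij \<phi>" using assms by (simp add: star_automorphism_def)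
  then have s: "\<phi> (inv_into UNIV \<phi> x) = x" for x
    by (simp add: bij_is_surj surj_f_inv_f)
  have i: "\<phi> u = v \<Longrightarrow> inv_into UNIV \<phi> v = u" for u v
    using b by (metis bij_inv_eq_iff)
  show ?thesis
    using assms unfolding star_automorphism_def
    by (auto intro!: i bij_imp_bij_inv simp: s)
qed

lemma group_Aut: "group (Aut :: ('a::cstar_algebra \<Rightarrow> 'a) monoid)"
proof (rule groupI)
  fix \<phi> :: "'a \<Rightarrow> 'a" assume "\<phi> \<in> carrier Aut"
  then have a: "star_automorphism \<phi>" by (simp add: Aut_def)
  then have "inv_into UNIV \<phi> \<circ> \<phi> = id"
    by (simp add: star_automorphism_def bij_is_inj)
  with star_automorphism_inv[OF a] show "\<exists>\<psi>\<in>carrier Aut. \<psi> \<otimes>\<^bsub>Aut\<^esub> \<phi> = \<one>\<^bsub>Aut\<^esub>"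
    by (auto simp: Aut_def)
qed (auto simp: Aut_def star_automorphism_def bij_comp)


section \<open>The multiplier algebra\<close>

text \<open>The multiplier algebra is realised as the C*-algebra of double centralizers.\<close>

definition bounded_clinear :: "('a::cstar_algebra \<Rightarrow> 'a) \<Rightarrow> bool" where
  "bounded_clinear T \<longleftrightarrow> bounded_linear T \<and> (\<forall>z x. T (z *\<^sub>C x) = z *\<^sub>C T x)"

definition double_centralizer :: "('a::cstar_algebra \<Rightarrow> 'a) \<Rightarrow> ('a \<Rightarrow> 'a) \<Rightarrow> bool" where
  "double_centralizer L R \<longleftrightarrow> bounded_clinear L \<and> bounded_clinear R \<and>
     (\<forall>a b. L (a * b) = L a * b) \<and> (\<forall>a b. R (a * b) = a * R b) \<and> (\<forall>a b. R a * b = a * L b)"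

named_theorems dc_intros

lemma dc_zero [dc_intros]: "double_centralizer (\<lambda>_. 0) (\<lambda>_. 0::'a::cstar_algebra)"
  using norm_scaleC[where 'a='a and x=0]
  by (simp add: double_centralizer_def bounded_clinear_def bounded_linear_zero)

lemma dc_one [dc_intros]: "double_centralizer (\<lambda>x. x) (\<lambda>x. x::'a::cstar_algebra)"
  by (simp add: double_centralizer_def bounded_clinear_def bounded_linear_ident)

lemma dc_add [dc_intros]:
  assumes "double_centralizer L R" "double_centralizer L' R'"
  shows "double_centralizer (\<lambda>x. L x + L' x) (\<lambda>x. R x + R' x)"
  using assms
  by (simp add: double_centralizer_def bounded_clinear_def bounded_linear_add
      scaleC_add_right algebra_simps)

lemma bounded_linear_scaleC: "bounded_linear (\<lambda>x::'a::cstar_algebra. z *\<^sub>C x)"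
proof (rule bounded_linear_intro[where K="cmod z"])
  show "z *\<^sub>C (r *\<^sub>R x) = r *\<^sub>R (z *\<^sub>C x)" for r and x :: 'a
    by (metis scaleC_of_real scaleC_scaleC mult.commute)
qed (simp_all add: scaleC_add_right norm_scaleC)

lemma dc_scaleC [dc_intros]:
  fixes L R :: "'a::cstar_algebra \<Rightarrow> 'a"
  assumes "double_centralizer L R"
  shows "double_centralizer (\<lambda>x. z *\<^sub>C L x) (\<lambda>x. z *\<^sub>C R x)"
  using assms bounded_linear_compose[OF bounded_linear_scaleC, of L z]
    bounded_linear_compose[OF bounded_linear_scaleC, of R z]
  by (simp add: double_centralizer_def bounded_clinear_def scaleC_mult_left scaleC_mult_right
      scaleC_scaleC mult.commute)

lemma dc_scaleR [dc_intros]: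
  assumes "double_centralizer L R"
  shows "double_centralizer (\<lambda>x. r *\<^sub>R L x) (\<lambda>x. r *\<^sub>R R x)"
  using dc_scaleC[OF assms, of "complex_of_real r"] by (simp add: scaleC_of_real)

lemma dc_uminus [dc_intros]:
  assumes "double_centralizer L R"
  shows "double_centralizer (\<lambda>x. - L x) (\<lambda>x. - R x)"
  using dc_scaleR[OF assms, of "-1"] by simp

lemma dc_diff [dc_intros]:
  assumes "double_centralizer L R" "double_centralizer L' R'"
  shows "double_centralizer (\<lambda>x. L x - L' x) (\<lambda>x. R x - R' x)"
  using dc_add[OF assms(1) dc_uminus[OF assms(2)]] by simp

lemma dc_times [dc_intros]:
  assumes "double_centralizer L R" "double_centralizer L' R'"
  shows "double_centralizer (\<lambda>x. L (L' x)) (\<lambda>x. R' (R x))"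
  using assms
  by (simp add: double_centralizer_def bounded_clinear_def bounded_linear_compose)

lemma dc_star [dc_intros]:
  assumes "double_centralizer L R"
  shows "double_centralizer (\<lambda>x. star (R (star x))) (\<lambda>x. star (L (star x)))"
proof -
  have b: "bounded_linear (star :: 'a \<Rightarrow> 'a)"
    by (rule bounded_linear_intro[where K=1]) (simp_all add: star_add star_scaleR)
  have s: "star x * y = star (star y * x)" for x y :: 'a
    by (simp add: star_mult star_star)
  show ?thesis
    using assms bounded_linear_compose[OF b bounded_linear_compose[OF _ b]]
    by (auto simp: double_centralizer_def bounded_clinear_def star_scaleC star_mult star_star)
      (metis star_mult star_star)
qed

lemma dc_inner [dc_intros]: "double_centralizer (\<lambda>x. a * x) (\<lambda>x. x * (a::'a::cstar_algebra))"
  by (simp add: double_centralizer_def bounded_clinear_def bounded_linear_mult_left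
      bounded_linear_mult_right scaleC_mult_left scaleC_mult_right mult.assoc)

typedef (overloaded) 'a multiplier =
  "{(L, R). double_centralizer L (R :: 'a::cstar_algebra \<Rightarrow> 'a)}"
  using dc_zero by blast

definition lmul :: "'a::cstar_algebra multiplier \<Rightarrow> 'a \<Rightarrow> 'a" where
  "lmul m = fst (Rep_multiplier m)"

definition rmul :: "'a::cstar_algebra multiplier \<Rightarrow> 'a \<Rightarrow> 'a" where
  "rmul m = snd (Rep_multiplier m)"

definition Mult :: "('a::cstar_algebra \<Rightarrow> 'a) \<Rightarrow> ('a \<Rightarrow> 'a) \<Rightarrow> 'a multiplier" where
  "Mult L R = Abs_multiplier (L, R)"

lemma dc_mul: "double_centralizer (lmul m) (rmul m)"
  using Rep_multiplier[of m] by (auto simp: lmul_def rmul_def)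

lemma lmul_Mult [simp]: "double_centralizer L R \<Longrightarrow> lmul (Mult L R) = L"
  and rmul_Mult [simp]: "double_centralizer L R \<Longrightarrow> rmul (Mult L R) = R"
  by (simp_all add: lmul_def rmul_def Mult_def Abs_multiplier_inverse)

lemma multiplier_eqI: "(\<And>x. lmul m x = lmul n x) \<Longrightarrow> (\<And>x. rmul m x = rmul n x) \<Longrightarrow> m = n"
  by (metis Rep_multiplier_inject ext lmul_def rmul_def prod.expand)

lemma bounded_linear_lmul: "bounded_linear (lmul m)"
  and bounded_linear_rmul: "bounded_linear (rmul m)"
  and lmul_scaleC: "lmul m (z *\<^sub>C x) = z *\<^sub>C lmul m x"
  and rmul_scaleC: "rmul m (z *\<^sub>C x) = z *\<^sub>C rmul m x"
  and lmul_mult: "lmul m (a * b) = lmul m a * b"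
  and rmul_mult: "rmul m (a * b) = a * rmul m b"
  and rmul_lmul: "rmul m a * b = a * lmul m b"
  using dc_mul[of m] by (simp_all add: double_centralizer_def bounded_clinear_def)

lemmas mul_add = linear_add[OF bounded_linear.linear[OF bounded_linear_lmul]]
  linear_add[OF bounded_linear.linear[OF bounded_linear_rmul]]
lemmas mul_scaleR = linear_scale[OF bounded_linear.linear[OF bounded_linear_lmul]]
  linear_scale[OF bounded_linear.linear[OF bounded_linear_rmul]]

lemma norm_le_lmul:
  fixes m :: "'a::cstar_algebra multiplier"
  shows "onorm (lmul m) \<le> onorm (rmul m)"
proof (rule onorm_bound)
  show "0 \<le> onorm (rmul m)" by (rule onorm_pos_le[OF bounded_linear_rmul])
  fix x
  let ?y = "lmul m x"
  have "norm ?y * norm ?y = norm (rmul m (star ?y) * x)"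
    by (simp add: rmul_lmul cstar_identity power2_eq_square)
  also have "\<dots> \<le> norm (rmul m (star ?y)) * norm x" by (rule norm_mult_ineq)
  also have "\<dots> \<le> (onorm (rmul m) * norm (star ?y)) * norm x"
    by (rule mult_right_mono[OF onorm[OF bounded_linear_rmul]]) simp
  finally have *: "norm ?y * norm ?y \<le> (onorm (rmul m) * norm x) * norm ?y"
    by (simp add: mult_ac)
  show "norm ?y \<le> onorm (rmul m) * norm x"
  proof (cases "?y = 0")
    case True
    then show ?thesis by (simp add: onorm_pos_le[OF bounded_linear_rmul])
  next
    case False
    with * show ?thesis by simp
  qed
qed

lemma norm_le_rmul:
  fixes m :: "'a::cstar_algebra multiplier"
  shows "onorm (rmul m) \<le> onorm (lmul m)"
proof (rule onorm_bound)
  show "0 \<le> onorm (lmul m)" by (rule onorm_pos_le[OF bounded_linear_lmul])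
  fix x
  let ?y = "rmul m x"
  have "norm ?y * norm ?y = norm (x * lmul m (star ?y))"
    using cstar_identity[of "star ?y"]
    by (simp add: rmul_lmul[symmetric] power2_eq_square star_star)
  also have "\<dots> \<le> norm x * norm (lmul m (star ?y))" by (rule norm_mult_ineq)
  also have "\<dots> \<le> norm x * (onorm (lmul m) * norm (star ?y))"
    by (rule mult_left_mono[OF onorm[OF bounded_linear_lmul]]) simp
  finally have *: "norm ?y * norm ?y \<le> (onorm (lmul m) * norm x) * norm ?y"
    by (simp add: mult_ac)
  show "norm ?y \<le> onorm (lmul m) * norm x"
  proof (cases "?y = 0")
    case True
    then show ?thesis by (simp add: onorm_pos_le[OF bounded_linear_lmul])
  next
    case False
    with * show ?thesis by simp
  qed
qed

lemma onorm_rmul: "onorm (rmul m) = onorm (lmul m)"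
  by (rule antisym[OF norm_le_rmul norm_le_lmul])

instantiation multiplier :: (cstar_algebra) real_normed_algebra
begin

definition "0 = Mult (\<lambda>_. 0) (\<lambda>_. 0)"
definition "m + n = Mult (\<lambda>x. lmul m x + lmul n x) (\<lambda>x. rmul m x + rmul n x)"
definition "m - n = Mult (\<lambda>x. lmul m x - lmul n x) (\<lambda>x. rmul m x - rmul n x)"
definition "- m = Mult (\<lambda>x. - lmul m x) (\<lambda>x. - rmul m x)"
definition "m * n = Mult (\<lambda>x. lmul m (lmul n x)) (\<lambda>x. rmul n (rmul m x))"
definition "r *\<^sub>R m = Mult (\<lambda>x. r *\<^sub>R lmul m x) (\<lambda>x. r *\<^sub>R rmul m x)"
definition "norm m = onorm (lmul m)"
definition "sgn (m::'a multiplier) = inverse (norm m) *\<^sub>R m"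
definition "dist m n = norm (m - n :: 'a multiplier)"
definition "(uniformity :: ('a multiplier \<times> 'a multiplier) filter) =
  (INF e\<in>{0<..}. principal {(m, n). dist m n < e})"
definition "open (U :: 'a multiplier set) =
  (\<forall>m\<in>U. eventually (\<lambda>(m', n). m' = m \<longrightarrow> n \<in> U) uniformity)"

lemma lmul_simps [simp]:
  "lmul 0 x = 0" "lmul (m + n) x = lmul m x + lmul n x" "lmul (m - n) x = lmul m x - lmul n x"
  "lmul (- m) x = - lmul m x" "lmul (m * n) x = lmul m (lmul n x)" "lmul (r *\<^sub>R m) x = r *\<^sub>R lmul m x"
  by (simp_all add: zero_multiplier_def plus_multiplier_def minus_multiplier_def
      uminus_multiplier_def times_multiplier_def scaleR_multiplier_def dc_intros dc_mul)

lemma rmul_simps [simp]: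
  "rmul 0 x = 0" "rmul (m + n) x = rmul m x + rmul n x" "rmul (m - n) x = rmul m x - rmul n x"
  "rmul (- m) x = - rmul m x" "rmul (m * n) x = rmul n (rmul m x)" "rmul (r *\<^sub>R m) x = r *\<^sub>R rmul m x"
  by (simp_all add: zero_multiplier_def plus_multiplier_def minus_multiplier_def
      uminus_multiplier_def times_multiplier_def scaleR_multiplier_def dc_intros dc_mul)

lemma norm_lmul: "norm (lmul m x) \<le> norm m * norm x"
  unfolding norm_multiplier_def by (rule onorm[OF bounded_linear_lmul])

lemma norm_rmul: "norm (rmul m x) \<le> norm m * norm x"
  unfolding norm_multiplier_def onorm_rmul[symmetric] by (rule onorm[OF bounded_linear_rmul])

lemma norm_multiplier_ge_0: "0 \<le> norm (m::'a multiplier)"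
  unfolding norm_multiplier_def by (rule onorm_pos_le[OF bounded_linear_lmul])

lemma norm_multiplier_le:
  "(\<And>x. norm (lmul m x) \<le> c * norm x) \<Longrightarrow> 0 \<le> c \<Longrightarrow> norm m \<le> c"
  unfolding norm_multiplier_def by (rule onorm_bound)

instance
proof
  fix m n k :: "'a multiplier" and r s :: real and U :: "'a multiplier set"
  show "m + n + k = m + (n + k)" by (rule multiplier_eqI) (simp_all add: add.assoc)
  show "m + n = n + m" by (rule multiplier_eqI) (simp_all add: add.commute)
  show "0 + m = m" by (rule multiplier_eqI) simp_all
  show "- m + m = 0" by (rule multiplier_eqI) simp_all
  show "m - n = m + - n" by (rule multiplier_eqI) simp_all
  show "m * n * k = m * (n * k)" by (rule multiplier_eqI) simp_all
  show "(m + n) * k = m * k + n * k" by (rule multiplier_eqI) (simp_all add: mul_add)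
  show "m * (n + k) = m * n + m * k" by (rule multiplier_eqI) (simp_all add: mul_add)
  show "r *\<^sub>R (m + n) = r *\<^sub>R m + r *\<^sub>R n" by (rule multiplier_eqI) (simp_all add: algebra_simps)
  show "(r + s) *\<^sub>R m = r *\<^sub>R m + s *\<^sub>R m" by (rule multiplier_eqI) (simp_all add: algebra_simps)
  show "r *\<^sub>R s *\<^sub>R m = (r * s) *\<^sub>R m" by (rule multiplier_eqI) simp_all
  show "1 *\<^sub>R m = m" by (rule multiplier_eqI) simp_all
  show "r *\<^sub>R m * n = r *\<^sub>R (m * n)" by (rule multiplier_eqI) (simp_all add: mul_scaleR)
  show "m * r *\<^sub>R n = r *\<^sub>R (m * n)" by (rule multiplier_eqI) (simp_all add: mul_scaleR)
  show "sgn m = inverse (norm m) *\<^sub>R m" by (simp add: sgn_multiplier_def)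
  show "dist m n = norm (m - n)" by (simp add: dist_multiplier_def)
  show "(uniformity :: ('a multiplier \<times> 'a multiplier) filter) =
      (INF e\<in>{0<..}. principal {(m, n). dist m n < e})" by (rule uniformity_multiplier_def)
  show "open U = (\<forall>m\<in>U. eventually (\<lambda>(m', n). m' = m \<longrightarrow> n \<in> U) uniformity)"
    by (rule open_multiplier_def)
  show "(norm m = 0) = (m = 0)"
  proof
    assume "norm m = 0"
    then show "m = 0"
      using norm_lmul[of m] norm_rmul[of m] by (intro multiplier_eqI) simp_all
  next
    assume "m = 0"
    then show "norm m = 0"
      using norm_multiplier_le[of m 0] norm_multiplier_ge_0[of m] by simp
  qed
  show "norm (m + n) \<le> norm m + norm n"
  proof (rule norm_multiplier_le)
    show "norm (lmul (m + n) x) \<le> (norm m + norm n) * norm x" for x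
      using norm_triangle_ineq[of "lmul m x" "lmul n x"] norm_lmul[of m x] norm_lmul[of n x]
      by (simp add: distrib_right)
  qed (simp add: norm_multiplier_ge_0)
  have eq: "lmul (r *\<^sub>R m) = (\<lambda>x. r *\<^sub>R lmul m x)" by auto
  show "norm (r *\<^sub>R m) = \<bar>r\<bar> * norm m"
    unfolding norm_multiplier_def eq by (rule onorm_scaleR[OF bounded_linear_lmul])
  show "norm (m * n) \<le> norm m * norm n"
  proof (rule norm_multiplier_le)
    show "norm (lmul (m * n) x) \<le> norm m * norm n * norm x" for x
      using norm_lmul[of m "lmul n x"] mult_left_mono[OF norm_lmul[of n x] norm_multiplier_ge_0[of m]]
      by (simp add: mult.assoc)
  qed (simp add: norm_multiplier_ge_0)
qed

end

instance multiplier :: (cstar_algebra) banach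
proof
  fix X :: "nat \<Rightarrow> 'a multiplier"
  assume C: "Cauchy X"
  have d: "norm (lmul (X i) x - lmul (X j) x) \<le> dist (X i) (X j) * norm x"
    "norm (rmul (X i) x - rmul (X j) x) \<le> dist (X i) (X j) * norm x" for i j x
    using norm_lmul[of "X i - X j" x] norm_rmul[of "X i - X j" x]
    by (simp_all add: dist_multiplier_def)
  define L where "L = (\<lambda>i. Blinfun (lmul (X i)))"
  define R where "R = (\<lambda>i. Blinfun (rmul (X i)))"
  have L: "blinfun_apply (L i) = lmul (X i)" and R: "blinfun_apply (R i) = rmul (X i)" for i
    by (simp_all add: L_def R_def bounded_linear_Blinfun_apply bounded_linear_lmul
        bounded_linear_rmul)
  have dL: "dist (L i) (L j) \<le> dist (X i) (X j)" and dR: "dist (R i) (R j) \<le> dist (X i) (X j)"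
    for i j
    unfolding dist_norm[of "L i" "L j"] dist_norm[of "R i" "R j"]
    by (rule norm_blinfun_bound;
        simp add: dist_multiplier_def norm_multiplier_ge_0 blinfun.diff_left L R
          d[unfolded dist_multiplier_def])+
  have "Cauchy L" "Cauchy R"
    using C unfolding Cauchy_def by (meson dL dR le_less_trans)+
  then obtain l r where l: "L \<longlonglongrightarrow> l" and r: "R \<longlonglongrightarrow> r"
    by (auto simp: Cauchy_convergent_iff convergent_def)
  have lx: "(\<lambda>i. lmul (X i) x) \<longlonglongrightarrow> l x" and rx: "(\<lambda>i. rmul (X i) x) \<longlonglongrightarrow> r x" for x
    using blinfun.tendsto[OF l tendsto_const[of x]] blinfun.tendsto[OF r tendsto_const[of x]]
    by (simp_all add: L R)
  have sc: "(\<lambda>i. z *\<^sub>C f i) \<longlonglongrightarrow> z *\<^sub>C a" if "f \<longlonglongrightarrow> a" for z and f :: "nat \<Rightarrow> 'a" and a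
    by (rule bounded_linear.tendsto[OF bounded_linear_scaleC that])
  have "double_centralizer l r"
    unfolding double_centralizer_def bounded_clinear_def
  proof (intro conjI allI blinfun.bounded_linear_right)
    fix z a b
    show "l (z *\<^sub>C a) = z *\<^sub>C l a"
      by (rule LIMSEQ_unique[OF lx]) (simp add: lmul_scaleC sc lx)
    show "r (z *\<^sub>C a) = z *\<^sub>C r a"
      by (rule LIMSEQ_unique[OF rx]) (simp add: rmul_scaleC sc rx)
    show "l (a * b) = l a * b"
      by (rule LIMSEQ_unique[OF lx]) (simp add: lmul_mult tendsto_mult lx)
    show "r (a * b) = a * r b"
      by (rule LIMSEQ_unique[OF rx]) (simp add: rmul_mult tendsto_mult rx)
    have "(\<lambda>i. rmul (X i) a * b) \<longlonglongrightarrow> r a * b" by (intro tendsto_intros rx)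
    moreover have "(\<lambda>i. a * lmul (X i) b) \<longlonglongrightarrow> a * l b" by (intro tendsto_intros lx)
    ultimately show "r a * b = a * l b"
      unfolding rmul_lmul by (rule LIMSEQ_unique)
  qed
  then have lM: "lmul (Mult l r) = l" by simp
  have le: "norm (X i - Mult l r) \<le> norm (L i - l)" for i
  proof (rule norm_multiplier_le)
    show "norm (lmul (X i - Mult l r) x) \<le> norm (L i - l) * norm x" for x
      using norm_blinfun[of "L i - l" x] by (simp add: lM blinfun.diff_left L)
  qed simp
  have t: "(\<lambda>i. norm (L i - l)) \<longlonglongrightarrow> 0"
    unfolding tendsto_norm_zero_iff by (rule LIM_zero[OF l])
  have "(\<lambda>i. norm (X i - Mult l r)) \<longlonglongrightarrow> 0"
    by (rule tendsto_sandwich[OF always_eventually always_eventually tendsto_const t])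
      (simp_all add: le)
  then have "X \<longlonglongrightarrow> Mult l r"
    unfolding tendsto_norm_zero_iff by (rule LIM_zero_cancel)
  then show "convergent X" by (rule convergentI)
qed

instantiation multiplier :: (cstar_algebra) cstar_algebra
begin

definition "z *\<^sub>C m = Mult (\<lambda>x. z *\<^sub>C lmul m x) (\<lambda>x. z *\<^sub>C rmul m x)"
definition "star m = Mult (\<lambda>x. star (rmul m (star x))) (\<lambda>x. star (lmul m (star x)))"

lemma mul_scaleC_star_simps [simp]:
  "lmul (z *\<^sub>C m) x = z *\<^sub>C lmul m x" "lmul (star m) x = star (rmul m (star x))"
  "rmul (z *\<^sub>C m) x = z *\<^sub>C rmul m x" "rmul (star m) x = star (lmul m (star x))"
  by (simp_all add: scaleC_multiplier_def star_multiplier_def dc_intros dc_mul)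

instance
proof
  fix m n :: "'a multiplier" and r :: real and z w :: complex
  show "z *\<^sub>C (m + n) = z *\<^sub>C m + z *\<^sub>C n" by (rule multiplier_eqI) (simp_all add: scaleC_add_right)
  show "(z + w) *\<^sub>C m = z *\<^sub>C m + w *\<^sub>C m" by (rule multiplier_eqI) (simp_all add: scaleC_add_left)
  show "z *\<^sub>C w *\<^sub>C m = (z * w) *\<^sub>C m" by (rule multiplier_eqI) (simp_all add: scaleC_scaleC)
  show "complex_of_real r *\<^sub>C m = r *\<^sub>R m" by (rule multiplier_eqI) (simp_all add: scaleC_of_real)
  have le: "norm (w *\<^sub>C k) \<le> cmod w * norm k" for w and k :: "'a multiplier"
    by (rule norm_multiplier_le)
      (simp_all add: norm_scaleC norm_multiplier_ge_0 mult.assoc mult_left_mono norm_lmul)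
  show "norm (z *\<^sub>C m) = cmod z * norm m"
  proof (cases "z = 0")
    case True
    with le[of z m] norm_multiplier_ge_0[of "z *\<^sub>C m"] show ?thesis by simp
  next
    case False
    then have m: "inverse z *\<^sub>C z *\<^sub>C m = m"
      by (intro multiplier_eqI) (simp_all add: scaleC_scaleC)
    have "norm m \<le> inverse (cmod z) * norm (z *\<^sub>C m)"
      using le[of "inverse z" "z *\<^sub>C m"] by (simp only: m norm_inverse)
    with False have "cmod z * norm m \<le> norm (z *\<^sub>C m)" by (simp add: field_simps)
    with le[of z m] show ?thesis by simp
  qed
  show "(z *\<^sub>C m) * n = z *\<^sub>C (m * n)"
    by (rule multiplier_eqI) (simp_all add: rmul_scaleC)
  show "m * (z *\<^sub>C n) = z *\<^sub>C (m * n)"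
    by (rule multiplier_eqI) (simp_all add: lmul_scaleC)
  show "star (m + n) = star m + star n" by (rule multiplier_eqI) (simp_all add: star_add)
  show "star (z *\<^sub>C m) = cnj z *\<^sub>C star m" by (rule multiplier_eqI) (simp_all add: star_scaleC)
  show "star (m * n) = star n * star m" by (rule multiplier_eqI) (simp_all add: star_star)
  show "star (star m) = m" by (rule multiplier_eqI) (simp_all add: star_star)
  have star_le: "norm (star k) \<le> norm k" for k :: "'a multiplier"
    by (rule norm_multiplier_le)
      (use norm_rmul[of k] in \<open>simp_all add: norm_multiplier_ge_0, metis norm_star\<close>)
  show "norm (star m * m) = (norm m)\<^sup>2"
  proof (rule antisym)
    have "norm (star m * m) \<le> norm (star m) * norm m"
    proof (rule norm_multiplier_le)
      show "norm (lmul (star m * m) x) \<le> norm (star m) * norm m * norm x" for x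
        using norm_lmul[of "star m" "lmul m x"]
          mult_left_mono[OF norm_lmul[of m x] norm_multiplier_ge_0[of "star m"]]
        by (simp add: mult.assoc)
    qed (simp add: norm_multiplier_ge_0)
    also have "\<dots> \<le> (norm m)\<^sup>2"
      by (simp add: power2_eq_square mult_right_mono star_le norm_multiplier_ge_0)
    finally show "norm (star m * m) \<le> (norm m)\<^sup>2" .
    have "norm m \<le> sqrt (norm (star m * m))"
    proof (rule norm_multiplier_le)
      fix x
      have "(norm (lmul m x))\<^sup>2 = norm (star (lmul m x) * lmul m x)"
        by (simp add: cstar_identity)
      also have "star (lmul m x) * lmul m x = star x * lmul (star m * m) x"
        using rmul_lmul[of "star m" "star x" "lmul m x"] by (simp add: star_star)
      also have "norm \<dots> \<le> norm x * norm (lmul (star m * m) x)"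
        by (rule norm_mult_ineq[of "star x", unfolded norm_star])
      also have "\<dots> \<le> norm x * (norm (star m * m) * norm x)"
        by (intro mult_left_mono norm_lmul) simp
      finally have "(norm (lmul m x))\<^sup>2 \<le> (sqrt (norm (star m * m)) * norm x)\<^sup>2"
        using norm_multiplier_ge_0[of "star m * m"]
        by (simp add: power_mult_distrib power2_eq_square mult_ac)
      then show "norm (lmul m x) \<le> sqrt (norm (star m * m)) * norm x"
        by (rule power2_le_imp_le) (simp add: norm_multiplier_ge_0)
    qed (simp add: norm_multiplier_ge_0)
    then show "(norm m)\<^sup>2 \<le> norm (star m * m)"
      using power_mono[of "norm m" "sqrt (norm (star m * m))" 2]
        norm_multiplier_ge_0[of m] norm_multiplier_ge_0[of "star m * m"] by simp
  qed
qed

end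

instantiation multiplier :: (cstar_algebra) monoid_mult
begin

definition "1 = Mult (\<lambda>x. x) (\<lambda>x. x)"

lemma mul_one [simp]: "lmul 1 x = x" "rmul 1 x = x"
  by (simp_all add: one_multiplier_def dc_one)

instance
  by standard (rule multiplier_eqI; simp)+

end

text \<open>The canonical embedding of \<open>A\<close> as an ideal of its multiplier algebra.\<close>

definition embed :: "'a::cstar_algebra \<Rightarrow> 'a multiplier" where
  "embed a = Mult (\<lambda>x. a * x) (\<lambda>x. x * a)"

lemma mul_embed [simp]: "lmul (embed a) x = a * x" "rmul (embed a) x = x * a"
  by (simp_all add: embed_def dc_inner)

lemma embed_hom:
  "embed (a + b) = embed a + embed b" "embed (a * b) = embed a * embed b"
  "embed (z *\<^sub>C a) = z *\<^sub>C embed a" "embed (star a) = star (embed a)"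
  by (rule multiplier_eqI;
      simp add: distrib_left distrib_right mult.assoc scaleC_mult_left scaleC_mult_right
        star_mult star_star)+

lemma embed_diff: "embed (a - b) = embed a - embed b"
  by (rule multiplier_eqI; simp add: algebra_simps)

lemma embed_ideal: "m * embed a = embed (lmul m a)" "embed a * m = embed (rmul m a)"
  by (rule multiplier_eqI; simp add: lmul_mult rmul_mult rmul_lmul)+

lemma norm_embed [simp]: "norm (embed a) = norm a"
proof (rule antisym)
  show "norm (embed a) \<le> norm a"
    by (rule norm_multiplier_le) (simp_all add: norm_mult_ineq)
  show "norm a \<le> norm (embed a)"
  proof (cases "a = 0")
    case False
    have "norm a * norm a \<le> norm (embed a) * norm a"
      using norm_lmul[of "embed a" "star a"] cstar_identity[of "star a"]
      by (simp add: power2_eq_square star_star)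
    with False show ?thesis by simp
  qed simp
qed

lemma star_diff: "star (x - y) = star x - star (y::'a::cstar_algebra)"
  using star_add[of x "- y"] by (simp add: star_minus)

lemma star_one [simp]: "star (1::'a::cstar_algebra multiplier) = 1"
  by (rule multiplier_eqI) (simp_all add: star_star)

lemma norm_one_le: "norm (1::'a::cstar_algebra multiplier) \<le> 1"
  by (rule norm_multiplier_le) simp_all

lemma sqrt_fixpoint:
  fixes a :: "'a::cstar_algebra"
  assumes "star a = a" "norm a < 1"
  obtains k where "star k = k" "k * a = a * k" "k + k = a * a + k * k"
proof -
  define s where "s = norm (a * a)"
  have "norm a * norm a < 1"
    using assms(2) mult_strict_mono[of "norm a" 1 "norm a" 1] by simp
  then have s: "0 \<le> s" "s < 1"
    using norm_mult_ineq[of a a] by (simp_all add: s_def)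
  define c where "c = 1 - sqrt (1 - s)"
  have c: "0 \<le> c" "c < 1" "s + c * c = 2 * c"
    using s by (simp_all add: c_def algebra_simps)
  let ?S = "{k. norm k \<le> c \<and> star k = k \<and> k * a = a * k}"
  let ?f = "\<lambda>k. (1/2) *\<^sub>R (a * a + k * k)"
  have "bounded_linear (star :: 'a \<Rightarrow> 'a)"
    by (rule bounded_linear_intro[where K=1]) (simp_all add: star_add star_scaleR)
  then have cs: "continuous_on UNIV (star :: 'a \<Rightarrow> 'a)"
    by (rule linear_continuous_on)
  have "\<exists>!k\<in>?S. ?f k = k"
  proof (rule Banach_fix)
    show "complete ?S"
      unfolding complete_eq_closed
      by (intro closed_Collect_conj closed_Collect_le closed_Collect_eq continuous_intros cs)
    show "?S \<noteq> {}" using c by (auto intro!: exI[of _ 0])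
    show "0 \<le> c" "c < 1" by fact+
    show "?f ` ?S \<subseteq> ?S"
    proof clarsimp
      fix k assume k: "norm k \<le> c" "star k = k" "k * a = a * k"
      have "norm (a * a + k * k) \<le> s + c * c"
        using norm_triangle_ineq[of "a * a" "k * k"] norm_mult_ineq[of k k]
          mult_mono[OF k(1) k(1) c(1) norm_ge_zero] by (simp add: s_def)
      moreover have "k * k * a = a * (k * k)"
        by (metis k(3) mult.assoc)
      ultimately show "norm (a * a + k * k) \<le> c * 2 \<and>
          star ((1/2) *\<^sub>R (a * a + k * k)) = (1/2) *\<^sub>R (a * a + k * k) \<and>
          (a * a + k * k) * a = a * (a * a + k * k)"
        using k c(3) assms(1)
        by (simp add: star_scaleR star_add star_mult distrib_left distrib_right mult.assoc)
    qed
    show "dist (?f k) (?f l) \<le> c * dist k l" if "k \<in> ?S" "l \<in> ?S" for k l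
    proof -
      have "?f k - ?f l = (1/2) *\<^sub>R (k * (k - l) + (k - l) * l)"
        by (simp add: algebra_simps)
      moreover have "norm (k * (k - l) + (k - l) * l) \<le> c * norm (k - l) + norm (k - l) * c"
        using that c(1) by (intro norm_triangle_le add_mono order_trans[OF norm_mult_ineq] mult_mono) auto
      ultimately show ?thesis by (simp add: dist_norm)
    qed
  qed
  then obtain k where k: "star k = k" "k * a = a * k" "?f k = k" by auto
  from k(3) have "2 *\<^sub>R k = 2 *\<^sub>R (?f k)" by simp
  then have "k + k = a * a + k * k" by (simp add: scaleR_2)
  with k that show thesis by blast
qed

lemma star_automorphism_norm_le:
  fixes \<phi> :: "'a::cstar_algebra \<Rightarrow> 'a"
  assumes "star_automorphism \<phi>"
  shows "norm (\<phi> x) \<le> norm x"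
proof -
  have add: "\<phi> (x + y) = \<phi> x + \<phi> y" and sc: "\<phi> (z *\<^sub>C x) = z *\<^sub>C \<phi> x"
    and mult: "\<phi> (x * y) = \<phi> x * \<phi> y" and st: "\<phi> (star x) = star (\<phi> x)" for x y z
    using assms by (simp_all add: star_automorphism_def)
  have unit: "norm (\<phi> a) \<le> 1" if a: "star a = a" "norm a < 1" for a
  proof -
    obtain k where k: "star k = k" "k * a = a * k" "k + k = a * a + k * k"
      using sqrt_fixpoint[OF a] by blast
    define X where "X = embed (\<phi> a)"
    define W where "W = 1 - embed (\<phi> k)"
    have 1: "star X = X" "star W = W"
      using a(1) k(1) by (simp_all add: X_def W_def star_diff flip: embed_hom st)
    have 2: "X * W = W * X"
      using k(2) by (simp add: X_def W_def algebra_simps flip: embed_hom mult)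
    have "embed (\<phi> k) + embed (\<phi> k) = X * X + embed (\<phi> k) * embed (\<phi> k)"
      using k(3) by (simp add: X_def flip: embed_hom mult add)
    then have 3: "X * X + W * W = 1"
      by (simp add: W_def algebra_simps)
    define u where "u = X + \<i> *\<^sub>C W"
    have su: "star u = X + (-\<i>) *\<^sub>C W"
      by (simp add: u_def star_add star_scaleC 1)
    have neg: "(-\<i>) *\<^sub>C m + \<i> *\<^sub>C m = 0" for m :: "'a multiplier"
      using scaleC_add_left[of "-\<i>" \<i> m] scaleC_of_real[of 0 m] by simp
    have "star u * u = (X * X + W * W) + ((-\<i>) *\<^sub>C (X * W) + \<i> *\<^sub>C (X * W))"
      by (simp add: su, simp add: u_def distrib_left distrib_right scaleC_mult_left
          scaleC_mult_right scaleC_scaleC scaleC_add_right 2 add_ac)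
    then have "star u * u = 1" by (simp only: 3 neg) simp
    then have "(norm u)\<^sup>2 \<le> 1"
      using norm_one_le[where 'a='a] by (simp flip: cstar_identity)
    then have nu: "norm u \<le> 1" by (simp add: power_le_one_iff)
    have "u + star u = (X + X) + ((-\<i>) *\<^sub>C W + \<i> *\<^sub>C W)"
      unfolding su by (simp add: u_def add_ac)
    then have "u + star u = 2 *\<^sub>R X" by (simp only: neg scaleR_2) simp
    then have "2 * norm X \<le> norm u + norm (star u)"
      using norm_triangle_ineq[of u "star u"] by simp
    with nu show ?thesis by (simp add: X_def)
  qed
  have sa: "norm (\<phi> b) \<le> norm b" if b: "star b = b" for b
  proof (rule dense_ge)
    fix c assume c: "norm b < c"
    then have c0: "0 < c" using norm_ge_zero le_less_trans by blast
    have "norm (\<phi> ((1/c) *\<^sub>R b)) \<le> 1"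
      by (rule unit) (use b c c0 in \<open>simp_all add: star_scaleR\<close>)
    moreover have "\<phi> ((1/c) *\<^sub>R b) = (1/c) *\<^sub>R \<phi> b"
      by (metis sc scaleC_of_real)
    ultimately show "norm (\<phi> b) \<le> c" using c0 by simp
  qed
  have "(norm (\<phi> x))\<^sup>2 \<le> (norm x)\<^sup>2"
    using sa[of "star x * x"] by (simp add: star_mult star_star mult st cstar_identity)
  then show ?thesis by (rule power2_le_imp_le) simp
qed

lemma dc_conj:
  fixes \<phi> \<psi> :: "'a::cstar_algebra \<Rightarrow> 'a"
  assumes \<phi>: "star_automorphism \<phi>" and \<psi>: "star_automorphism \<psi>"
    and inv: "\<And>x. \<phi> (\<psi> x) = x"
  shows "double_centralizer (\<lambda>x. \<phi> (lmul m (\<psi> x))) (\<lambda>x. \<phi> (rmul m (\<psi> x)))"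
proof -
  have bl: "bounded_linear f" if "star_automorphism f" for f :: "'a \<Rightarrow> 'a"
  proof (rule bounded_linear_intro[where K=1])
    show "f (r *\<^sub>R x) = r *\<^sub>R f x" for r x
      using that unfolding star_automorphism_def by (metis scaleC_of_real)
    show "f (x + y) = f x + f y" for x y
      using that by (simp add: star_automorphism_def)
    show "norm (f x) \<le> norm x * 1" for x
      using star_automorphism_norm_le[OF that] by simp
  qed
  have "bounded_linear (\<lambda>x. \<phi> (f (\<psi> x)))" if "bounded_linear f" for f :: "'a \<Rightarrow> 'a"
    by (rule bounded_linear_compose[OF bl[OF \<phi>] bounded_linear_compose[OF that bl[OF \<psi>]]])
  moreover have sc: "\<phi> (z *\<^sub>C x) = z *\<^sub>C \<phi> x" "\<psi> (z *\<^sub>C x) = z *\<^sub>C \<psi> x"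
    and mu: "\<phi> (x * y) = \<phi> x * \<phi> y" "\<psi> (x * y) = \<psi> x * \<psi> y" for z x y
    using \<phi> \<psi> by (simp_all add: star_automorphism_def)
  moreover have "\<phi> (rmul m (\<psi> a)) * b = a * \<phi> (lmul m (\<psi> b))" for a b
  proof -
    have "\<phi> (rmul m (\<psi> a)) * b = \<phi> (rmul m (\<psi> a) * \<psi> b)" by (simp only: mu inv)
    also have "\<dots> = a * \<phi> (lmul m (\<psi> b))" by (simp only: rmul_lmul mu inv)
    finally show ?thesis .
  qed
  ultimately show ?thesis
    by (simp add: double_centralizer_def bounded_clinear_def bounded_linear_lmul
        bounded_linear_rmul lmul_mult rmul_mult lmul_scaleC rmul_scaleC inv)
qed

text \<open>The extension of an automorphism to the multiplier algebra; it is the only one by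
  \<open>mult_ext_unique\<close>.\<close>

definition mult_ext :: "('a::cstar_algebra \<Rightarrow> 'a) \<Rightarrow> 'a multiplier \<Rightarrow> 'a multiplier" where
  "mult_ext \<phi> m =
     Mult (\<lambda>x. \<phi> (lmul m (inv_into UNIV \<phi> x))) (\<lambda>x. \<phi> (rmul m (inv_into UNIV \<phi> x)))"

context
  fixes \<phi> \<psi> :: "'a::cstar_algebra \<Rightarrow> 'a"
  assumes aut: "star_automorphism \<phi>"
  defines "\<psi> \<equiv> inv_into UNIV \<phi>"
begin

lemma aut_inv: "star_automorphism \<psi>"
  unfolding \<psi>_def by (rule star_automorphism_inv[OF aut])

lemma aut_simps:
  "\<phi> (\<psi> x) = x" "\<psi> (\<phi> x) = x"
  "\<phi> (x + y) = \<phi> x + \<phi> y" "\<phi> (z *\<^sub>C x) = z *\<^sub>C \<phi> x" "\<phi> (x * y) = \<phi> x * \<phi> y" "\<phi> (star x) = star (\<phi> x)"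
  "\<psi> (x + y) = \<psi> x + \<psi> y" "\<psi> (z *\<^sub>C x) = z *\<^sub>C \<psi> x" "\<psi> (x * y) = \<psi> x * \<psi> y" "\<psi> (star x) = star (\<psi> x)"
proof -
  show "\<phi> (\<psi> x) = x" "\<psi> (\<phi> x) = x"
    using aut by (simp_all add: star_automorphism_def \<psi>_def bij_is_surj surj_f_inv_f bij_is_inj)
qed (use aut aut_inv in \<open>simp_all add: star_automorphism_def\<close>)

lemma mul_mult_ext [simp]:
  "lmul (mult_ext \<phi> m) x = \<phi> (lmul m (\<psi> x))" "rmul (mult_ext \<phi> m) x = \<phi> (rmul m (\<psi> x))"
  using dc_conj[OF aut aut_inv aut_simps(1), of m] by (simp_all add: mult_ext_def \<psi>_def[symmetric])

lemma mult_ext_embed: "mult_ext \<phi> (embed a) = embed (\<phi> a)"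
  by (rule multiplier_eqI) (simp_all add: aut_simps)

lemma mult_ext_hom:
  "mult_ext \<phi> (m + n) = mult_ext \<phi> m + mult_ext \<phi> n"
  "mult_ext \<phi> (z *\<^sub>C m) = z *\<^sub>C mult_ext \<phi> m"
  "mult_ext \<phi> (m * n) = mult_ext \<phi> m * mult_ext \<phi> n"
  "mult_ext \<phi> (star m) = star (mult_ext \<phi> m)"
  by (rule multiplier_eqI; simp add: aut_simps)+

lemma mult_ext_automorphism: "star_automorphism (mult_ext \<phi>)"
proof -
  have dc: "double_centralizer (\<lambda>x. \<psi> (lmul m (\<phi> x))) (\<lambda>x. \<psi> (rmul m (\<phi> x)))" for m
    by (rule dc_conj[OF aut_inv aut]) (simp add: aut_simps)
  have "bij (mult_ext \<phi>)"
  proof (rule bijI)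
    show "inj (mult_ext \<phi>)"
    proof (rule injI)
      fix m n assume eq: "mult_ext \<phi> m = mult_ext \<phi> n"
      show "m = n"
      proof (rule multiplier_eqI)
        fix x
        have "\<phi> (lmul m (\<psi> (\<phi> x))) = \<phi> (lmul n (\<psi> (\<phi> x)))"
          "\<phi> (rmul m (\<psi> (\<phi> x))) = \<phi> (rmul n (\<psi> (\<phi> x)))"
          unfolding mul_mult_ext[symmetric] eq by (rule refl)+
        then show "lmul m x = lmul n x" "rmul m x = rmul n x"
          by (metis aut_simps(2))+
      qed
    qed
    show "surj (mult_ext \<phi>)"
    proof (rule surjI)
      fix m
      show "mult_ext \<phi> (Mult (\<lambda>x. \<psi> (lmul m (\<phi> x))) (\<lambda>x. \<psi> (rmul m (\<phi> x)))) = m"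
        by (rule multiplier_eqI) (simp_all add: dc aut_simps)
    qed
  qed
  then show ?thesis by (simp add: star_automorphism_def mult_ext_hom)
qed

lemma mult_ext_unique:
  assumes "star_automorphism \<Phi>" and "\<And>a. \<Phi> (embed a) = embed (\<phi> a)"
  shows "\<Phi> = mult_ext \<phi>"
proof (rule ext, rule multiplier_eqI)
  fix m x
  have inj: "embed a = embed b \<Longrightarrow> a = b" for a b :: 'a
    by (metis embed_diff norm_embed norm_eq_zero right_minus_eq)
  have "embed (lmul (\<Phi> m) x) = \<Phi> m * \<Phi> (embed (\<psi> x))"
    by (simp add: assms(2) embed_ideal aut_simps)
  also have "\<dots> = \<Phi> (m * embed (\<psi> x))"
    using assms(1) by (simp add: star_automorphism_def)
  also have "\<dots> = embed (lmul (mult_ext \<phi> m) x)"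
    by (simp add: embed_ideal assms(2))
  finally show "lmul (\<Phi> m) x = lmul (mult_ext \<phi> m) x" by (rule inj)
  have "embed (rmul (\<Phi> m) x) = \<Phi> (embed (\<psi> x)) * \<Phi> m"
    by (simp add: assms(2) embed_ideal aut_simps)
  also have "\<dots> = \<Phi> (embed (\<psi> x) * m)"
    using assms(1) by (simp add: star_automorphism_def)
  also have "\<dots> = embed (rmul (mult_ext \<phi> m) x)"
    by (simp add: embed_ideal assms(2))
  finally show "rmul (\<Phi> m) x = rmul (mult_ext \<phi> m) x" by (rule inj)
qed

end


section \<open>Rokhlin properties\<close>

text \<open>Both are meant for an action \<open>\<alpha> \<in> hom G Aut\<close> of a finite group; families indexed by the
  group are functions of which only the values on \<open>carrier G\<close> matter.\<close>

definition multiplier_rokhlin ::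
    "('g, 'b) monoid_scheme \<Rightarrow> ('g \<Rightarrow> 'a::cstar_algebra \<Rightarrow> 'a) \<Rightarrow> bool" where
  "multiplier_rokhlin G \<alpha> \<longleftrightarrow>
     (\<forall>F \<epsilon>. finite F \<and> \<epsilon> > 0 \<longrightarrow>
       (\<exists>p :: 'g \<Rightarrow> 'a multiplier.
          (\<forall>g\<in>carrier G. is_projection (p g)) \<and>
          (\<forall>g\<in>carrier G. \<forall>h\<in>carrier G. g \<noteq> h \<longrightarrow> p g * p h = 0) \<and>
          (\<forall>g\<in>carrier G. \<forall>h\<in>carrier G. norm (mult_ext (\<alpha> g) (p h) - p (g \<otimes>\<^bsub>G\<^esub> h)) < \<epsilon>) \<and>
          (\<forall>g\<in>carrier G. \<forall>a\<in>F. norm (p g * embed a - embed a * p g) < \<epsilon>) \<and>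
          (\<Sum>g\<in>carrier G. p g) = 1))"

definition rokhlin ::
    "('g, 'b) monoid_scheme \<Rightarrow> ('g \<Rightarrow> 'a::cstar_algebra \<Rightarrow> 'a) \<Rightarrow> bool" where
  "rokhlin G \<alpha> \<longleftrightarrow>
     (\<forall>\<epsilon> F. \<epsilon> > 0 \<and> finite F \<longrightarrow>
       (\<exists>r :: 'g \<Rightarrow> 'a.
          (\<forall>g\<in>carrier G. is_positive (r g) \<and> norm (r g) \<le> 1) \<and>
          (\<forall>g\<in>carrier G. \<forall>h\<in>carrier G. g \<noteq> h \<longrightarrow> r g * r h = 0) \<and>
          (\<forall>g\<in>carrier G. \<forall>h\<in>carrier G. norm (\<alpha> g (r h) - r (g \<otimes>\<^bsub>G\<^esub> h)) < \<epsilon>) \<and>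
          (\<forall>a\<in>F. \<forall>g\<in>carrier G. norm (r g * a - a * r g) < \<epsilon>) \<and>
          (\<forall>a\<in>F. norm ((\<Sum>g\<in>carrier G. r g) * a - a) < \<epsilon>)))"

end

theory Submission
  imports Defs
begin

text \<open>
  Choose a self-adjoint contraction \<open>e \<in> A\<close> that is fixed by the action and is an approximate
  unit for the given finite set, and put \<open>r\<^sub>g = p\<^sub>g e\<^sup>2 p\<^sub>g\<close>. As the \<open>p\<^sub>g\<close> almost commute with the
  finite set, \<open>e\<close> need not almost commute with the \<open>p\<^sub>g\<close>.

  To find \<open>e\<close> without positivity theory, note that for a contraction \<open>V\<close> the Cesaro mean \<open>f\<close> of
  \<open>1, V, \<dots>, V\<^bsup>n-1\<^esup>\<close> is a contraction with \<open>\<parallel>f (1 - V)\<parallel> \<le> 2 / n\<close>. For \<open>V = 1 - d\<^sup>2\<close>, where \<open>d\<close> is a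
  multiple of \<open>a a\<^sup>*\<close>, the C*-identity makes \<open>f a\<close> small. Multiplying such contractions handles
  finitely many elements; then \<open>1 - (f\<^sup>* f)\<^sup>2\<close> is an approximate unit, and averaging it
  over the group makes it invariant.
\<close>

section \<open>Contractions in the multiplier algebra\<close>

lemma norm_projection_le:
  assumes "is_projection p"
  shows "norm p \<le> 1"
proof -
  have "norm p * norm p = norm p"
    using cstar_identity[of p] assms by (simp add: is_projection_def power2_eq_square)
  then show ?thesis by auto
qed

lemma norm_mult_le_one:
  fixes x y :: "'a::real_normed_algebra"
  assumes "norm x \<le> 1" "norm y \<le> 1"
  shows "norm (x * y) \<le> 1"
  using norm_mult_ineq[of x y] mult_mono[OF assms] by simp

lemma norm_mult_le_left:
  fixes x y :: "'a::real_normed_algebra"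
  assumes "norm y \<le> 1"
  shows "norm (x * y) \<le> norm x"
  using norm_mult_ineq[of x y] mult_left_mono[OF assms norm_ge_zero[of x]] by simp

lemma norm_mult_le_right:
  fixes x y :: "'a::real_normed_algebra"
  assumes "norm x \<le> 1"
  shows "norm (x * y) \<le> norm y"
  using norm_mult_ineq[of x y] mult_right_mono[OF assms norm_ge_zero[of y]] by simp

text \<open>The fixed point \<open>k\<close> of \<open>sqrt_fixpoint\<close> satisfies (1 - k)^2 = 1
  - y^2, so \<open>1 - y * y\<close> is the square of \<open>W = 1 - k\<close>; and \<open>W\<close>
  is a contraction because it is the real part of an element \<open>u\<close> with
  \<open>star u * u = 1\<close>.\<close>

lemma norm_one_minus_square_le_strict:
  fixes y :: "'a::cstar_algebra multiplier"
  assumes y: "star y = y" "norm y < 1"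
  shows "norm (1 - y * y) \<le> 1"
proof -
  obtain k where k: "star k = k" "k * y = y * k" "k + k = y * y + k * k"
    using sqrt_fixpoint[OF y] by blast
  define W where "W = 1 - k"
  have W: "star W = W" "y * W = W * y" "y * y + W * W = 1"
    using k by (simp_all add: W_def star_diff algebra_simps)
  \<comment> \<open>The unitary whose real and imaginary parts are \<open>W\<close> and \<open>y\<close>.\<close>
  define u where "u = W + \<i> *\<^sub>C y"
  have su: "star u = W + (-\<i>) *\<^sub>C y"
    by (simp add: u_def star_add star_scaleC W y)
  have neg: "(-\<i>) *\<^sub>C m + \<i> *\<^sub>C m = 0" for m :: "'a multiplier"
    using scaleC_add_left[of "-\<i>" \<i> m] scaleC_of_real[of 0 m] by simp
  have "star u * u = (y * y + W * W) + ((-\<i>) *\<^sub>C (y * W) + \<i> *\<^sub>C (y * W))"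
    by (simp add: su, simp add: u_def distrib_left distrib_right scaleC_mult_left
        scaleC_mult_right scaleC_scaleC scaleC_add_right W add_ac)
  then have "star u * u = 1" by (simp only: W neg) simp
  then have "(norm u)\<^sup>2 \<le> 1"
    using norm_one_le[where 'a='a] by (simp flip: cstar_identity)
  then have nu: "norm u \<le> 1" by (simp add: power_le_one_iff)
  have "u + star u = (W + W) + ((-\<i>) *\<^sub>C y + \<i> *\<^sub>C y)"
    unfolding su by (simp add: u_def add_ac)
  then have "u + star u = 2 *\<^sub>R W" by (simp only: neg scaleR_2) simp
  then have "2 * norm W \<le> norm u + norm (star u)"
    using norm_triangle_ineq[of u "star u"] by simp
  with nu have "norm W \<le> 1" by simp
  then have "norm (W * W) \<le> 1" by (simp add: norm_mult_le_one)
  moreover have "1 - y * y = W * W" using W(3) by (simp add: algebra_simps)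
  ultimately show ?thesis by simp
qed

text \<open>For 0 < t < 1 the strict case applies to \<open>t *\<^sub>R y\<close>, and the bound
  survives the limit as t tends to 1 from below.\<close>

lemma norm_one_minus_square_le:
  fixes y :: "'a::cstar_algebra multiplier"
  assumes y: "star y = y" "norm y \<le> 1"
  shows "norm (1 - y * y) \<le> 1"
proof -
  have "((\<lambda>t::real. norm (1 - (t *\<^sub>R y) * (t *\<^sub>R y))) \<longlongrightarrow> norm (1 - (1 *\<^sub>R y) * (1 *\<^sub>R y))) (at_left 1)"
    by (intro tendsto_intros)
  moreover have "\<forall>\<^sub>F t::real in at_left 1. norm (1 - (t *\<^sub>R y) * (t *\<^sub>R y)) \<le> 1"
  proof (rule eventually_mono)
    show "\<forall>\<^sub>F t::real in at_left 1. t \<in> {0<..<1}"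
      by (rule eventually_at_left_real) simp
    fix t :: real assume t: "t \<in> {0<..<1}"
    then have "norm (t *\<^sub>R y) < 1"
      using mult_left_mono[OF y(2), of t] by (simp, linarith)
    then show "norm (1 - (t *\<^sub>R y) * (t *\<^sub>R y)) \<le> 1"
      by (intro norm_one_minus_square_le_strict) (simp_all add: star_scaleR y)
  qed
  ultimately show ?thesis
    using tendsto_upperbound[of _ _ "at_left (1::real)" 1] by (simp add: trivial_limit_at_left_real)
qed

section \<open>Approximate units\<close>

lemma embed_zero [simp]: "embed 0 = 0"
  by (rule multiplier_eqI) simp_all

lemma zero_in_range_embed [simp]: "0 \<in> range embed"
  by (metis embed_zero rangeI)

lemma range_embed_add: "m \<in> range embed \<Longrightarrow> n \<in> range embed \<Longrightarrow> m + n \<in> range embed"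
  by (auto simp flip: embed_hom)

lemma range_embed_mult:
  "m \<in> range embed \<Longrightarrow> n * m \<in> range embed"
  "m \<in> range embed \<Longrightarrow> m * n \<in> range embed"
  by (auto simp: embed_ideal)

text \<open>The multipliers congruent to 1 modulo the ideal A form a monoid; this keeps the products
  and powers below of the form 1 minus an element of A.\<close>

lemma one_minus_mult_in_range_embed:
  assumes "1 - m \<in> range embed" "1 - n \<in> range embed"
  shows "1 - m * n \<in> range embed"
proof -
  have "1 - m * n = (1 - m) + m * (1 - n)" by (simp add: right_diff_distrib)
  then show ?thesis by (simp only: range_embed_add range_embed_mult assms)
qed

lemma one_minus_power_in_range_embed:
  fixes V :: "'a::cstar_algebra multiplier"
  assumes "1 - V \<in> range embed"
  shows "1 - V ^ k \<in> range embed"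
  by (induction k) (simp_all add: one_minus_mult_in_range_embed assms)

lemma embed_scaleR: "embed (r *\<^sub>R a) = r *\<^sub>R embed a"
  by (simp add: embed_hom flip: scaleC_of_real)

lemma embed_inject: "embed a = embed b \<longleftrightarrow> a = b"
  by (metis embed_diff norm_embed norm_eq_zero right_minus_eq)

text \<open>Against \<open>1 - V\<close> the sum of powers telescopes to \<open>1 - V ^ n\<close>,
  of norm at most 2, and the factor 1/n remains. Moreover \<open>1 - f\<close> is the mean of the
  elements \<open>1 - V ^ k\<close> of the ideal.\<close>

lemma cesaro_mean:
  fixes V :: "'a::cstar_algebra multiplier"
  assumes V: "norm V \<le> 1" "1 - V \<in> range embed" and n: "n > 0"
  obtains f where "1 - f \<in> range embed" "norm f \<le> 1" "norm (f * (1 - V)) \<le> 2 / real n"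
proof
  define f where "f = (1 / real n) *\<^sub>R (\<Sum>k<n. V ^ k)"
  have np: "norm (V ^ k) \<le> 1" for k
    by (induction k) (simp_all add: norm_one_le norm_mult_le_one V)
  have "(\<Sum>k<j. 1 - V ^ k) \<in> range embed" for j
    by (induction j) (simp_all add: range_embed_add one_minus_power_in_range_embed[OF V(2)])
  then obtain x where x: "(\<Sum>k<n. 1 - V ^ k) = embed x" by blast
  have "(\<Sum>k<n. 1 - V ^ k) = real n *\<^sub>R 1 - (\<Sum>k<n. V ^ k)"
    by (simp add: sum_subtractf sum_constant_scaleR)
  then have "1 - f = (1 / real n) *\<^sub>R (\<Sum>k<n. 1 - V ^ k)"
    using n by (simp add: f_def scaleR_diff_right)
  then show "1 - f \<in> range embed" by (simp add: x flip: embed_scaleR)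
  have "norm (\<Sum>k<n. V ^ k) \<le> real n"
    using sum_norm_le[of "{..<n}" "\<lambda>k. V ^ k" "\<lambda>_. 1"] np by simp
  then show "norm f \<le> 1" using n by (simp add: f_def)
  have "(\<Sum>k<j. V ^ k) * (1 - V) = 1 - V ^ j" for j
  proof (induction j)
    case (Suc j)
    have "(\<Sum>k<Suc j. V ^ k) * (1 - V) = (\<Sum>k<j. V ^ k) * (1 - V) + (V ^ j - V ^ j * V)"
      by (simp add: algebra_simps)
    with Suc show ?case by (simp add: power_commutes)
  qed simp
  then have "norm (f * (1 - V)) = norm (1 - V ^ n) / real n"
    by (simp add: f_def)
  moreover have "norm (1 - V ^ n) \<le> 2"
    using norm_triangle_ineq4[of 1 "V ^ n"] np[of n] norm_one_le[where 'a='a] by simp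
  ultimately show "norm (f * (1 - V)) \<le> 2 / real n"
    by (simp add: divide_right_mono)
qed

text \<open>The C*-identity for \<open>star (f * x)\<close> produces
  \<open>f * (x * star x) * star f\<close>, whose last factor is a contraction.\<close>

lemma norm_mult_square_le:
  fixes f x :: "'a::cstar_algebra"
  assumes "norm f \<le> 1"
  shows "(norm (f * x))\<^sup>2 \<le> norm (f * (x * star x))"
proof -
  have "(norm (f * x))\<^sup>2 = norm ((f * (x * star x)) * star f)"
    using cstar_identity[of "star (f * x)"]
    by (simp only: norm_star star_star) (simp add: star_mult mult.assoc)
  also have "\<dots> \<le> norm (f * (x * star x))"
    by (rule norm_mult_le_left) (simp add: assms)
  finally show ?thesis .
qed

lemma small_multiple_single:
  fixes a :: "'a::cstar_algebra"
  assumes "\<epsilon> > 0"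
  obtains f where "1 - f \<in> range embed" "norm f \<le> 1" "norm (f * embed a) < \<epsilon>"
proof -
  \<comment> \<open>The scale makes \<open>d\<close> a contraction; the summand 1 in the denominator
    covers a = 0.\<close>
  define t where "t = 1 / (1 + (norm a)\<^sup>2)"
  have t: "t > 0" "t * (norm a)\<^sup>2 \<le> 1"
    by (simp_all add: t_def add_pos_nonneg)
  define d where "d = embed (t *\<^sub>R (a * star a))"
  have d: "star d = d" "norm d \<le> 1"
    using t cstar_identity[of "star a"]
    by (simp_all add: d_def star_scaleR star_mult star_star flip: embed_hom(4))
  define V where "V = 1 - d * d"
  have V: "norm V \<le> 1" "1 - V \<in> range embed"
    using norm_one_minus_square_le[OF d] by (auto simp: V_def d_def simp flip: embed_hom)
  \<comment> \<open>The target is squared twice because \<open>norm_mult_square_le\<close> is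
    applied twice: from \<open>f * (d * d)\<close> to \<open>f * d\<close>, and from there, after
    division by \<open>t\<close>, to \<open>f * embed a\<close>.\<close>
  have "0 < (t * \<epsilon>\<^sup>2)\<^sup>2 / 2" using t assms by simp
  from reals_Archimedean[OF this] obtain m where m: "inverse (real (Suc m)) < (t * \<epsilon>\<^sup>2)\<^sup>2 / 2"
    by blast
  obtain f where f: "1 - f \<in> range embed" "norm f \<le> 1" "norm (f * (1 - V)) \<le> 2 / real (Suc m)"
    using cesaro_mean[OF V, of "Suc m"] by blast
  have "(norm (f * d))\<^sup>2 \<le> norm (f * (d * d))"
    using norm_mult_square_le[OF f(2), of d] d by simp
  also have "\<dots> < (t * \<epsilon>\<^sup>2)\<^sup>2"
    using f(3) m by (simp add: V_def inverse_eq_divide)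
  finally have fd: "norm (f * d) < t * \<epsilon>\<^sup>2"
    by (rule power2_less_imp_less) (use t in simp)
  have "f * d = t *\<^sub>R (f * (embed a * star (embed a)))"
    by (simp add: d_def embed_scaleR embed_hom)
  with fd t have "norm (f * (embed a * star (embed a))) < \<epsilon>\<^sup>2" by simp
  with norm_mult_square_le[OF f(2), of "embed a"] have "(norm (f * embed a))\<^sup>2 < \<epsilon>\<^sup>2" by simp
  then have "norm (f * embed a) < \<epsilon>"
    by (rule power2_less_imp_less) (use assms in simp)
  with f that show thesis by blast
qed

text \<open>In the induction step the new factor \<open>g\<close> is fitted to f a, which lies in A
  because A is an ideal. It multiplies \<open>f\<close> from the left, so as a contraction it
  preserves the bounds already obtained.\<close>

lemma small_multiple_finite:
  fixes F :: "'a::cstar_algebra set"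
  assumes "finite F" and \<epsilon>: "\<epsilon> > 0"
  shows "\<exists>f. 1 - f \<in> range embed \<and> norm f \<le> 1 \<and> (\<forall>a\<in>F. norm (f * embed a) < \<epsilon>)"
  using assms(1)
proof induction
  case empty
  show ?case by (rule exI[of _ 1]) (simp add: norm_one_le)
next
  case (insert a F)
  then obtain f where f: "1 - f \<in> range embed" "norm f \<le> 1" "\<forall>a\<in>F. norm (f * embed a) < \<epsilon>"
    by blast
  obtain g where g: "1 - g \<in> range embed" "norm g \<le> 1" "norm (g * embed (lmul f a)) < \<epsilon>"
    using small_multiple_single[OF \<epsilon>] by blast
  have "norm (g * f * embed b) < \<epsilon>" if "b \<in> F" for b
    using norm_mult_le_right[OF g(2), of "f * embed b"] f(3) that by (force simp: mult.assoc)
  moreover have "norm (g * f * embed a) < \<epsilon>"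
    using g(3) by (simp add: mult.assoc embed_ideal)
  moreover have "1 - g * f \<in> range embed" "norm (g * f) \<le> 1"
    by (intro one_minus_mult_in_range_embed norm_mult_le_one f g)+
  ultimately show ?case by blast
qed

text \<open>Squaring \<open>s = star f * f\<close> gives \<open>e\<close> the form 1 - s^2, to which
  \<open>norm_one_minus_square_le\<close> applies. As \<open>s\<close> ends in \<open>f\<close>, the
  error s^2 a is a contraction times f a.\<close>

lemma approximate_unit:
  fixes F :: "'a::cstar_algebra set"
  assumes "finite F" "\<epsilon> > 0"
  obtains e where "star e = e" "norm e \<le> 1" "\<And>a. a \<in> F \<Longrightarrow> norm (e * a - a) < \<epsilon>"
proof -
  obtain f where f: "1 - f \<in> range embed" "norm f \<le> 1" "\<And>a. a \<in> F \<Longrightarrow> norm (f * embed a) < \<epsilon>"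
    using small_multiple_finite[OF assms] by blast
  define s where "s = star f * f"
  have s: "star s = s" "norm s \<le> 1"
    using f(2) by (simp_all add: s_def star_mult star_star norm_mult_le_one)
  obtain x where x: "1 - f = embed x" using f(1) by blast
  \<comment> \<open>A is closed under adjoints, so \<open>star f\<close> is congruent to 1 as well,
    and hence so is \<open>s * s\<close>.\<close>
  have "1 - star f = embed (star x)"
    by (simp add: embed_hom star_diff flip: x)
  then have "1 - star f \<in> range embed" by blast
  with f(1) have "1 - s * s \<in> range embed"
    unfolding s_def by (intro one_minus_mult_in_range_embed)
  then obtain e where e: "embed e = 1 - s * s" by force
  show thesis
  proof
    have "embed (star e) = embed e"
      by (simp add: embed_hom(4) e star_diff star_mult s)
    then show "star e = e" by (simp add: embed_inject)
    show "norm e \<le> 1"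
      using norm_one_minus_square_le[OF s] by (simp flip: e)
    fix a assume a: "a \<in> F"
    have "embed (e * a - a) = - ((s * star f) * (f * embed a))"
      by (simp add: embed_diff embed_hom e algebra_simps) (simp add: s_def mult.assoc)
    then have "norm (e * a - a) = norm ((s * star f) * (f * embed a))"
      by (metis norm_embed norm_minus_cancel)
    also have "\<dots> \<le> norm (f * embed a)"
      by (intro norm_mult_le_right norm_mult_le_one s) (simp add: f)
    finally show "norm (e * a - a) < \<epsilon>" using f(3)[OF a] by simp
  qed
qed

section \<open>Averaging an approximate unit over the finite group\<close>

lemma star_automorphism_linear:
  assumes "star_automorphism \<phi>"
  shows "linear \<phi>"
proof (rule linearI)
  show "\<phi> (x + y) = \<phi> x + \<phi> y" for x y
    using assms by (simp add: star_automorphism_def)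
  show "\<phi> (r *\<^sub>R x) = r *\<^sub>R \<phi> x" for r x
    using assms unfolding star_automorphism_def by (metis scaleC_of_real)
qed

lemma star_sum: "star (\<Sum>i\<in>I. f i) = (\<Sum>i\<in>I. star (f i :: 'a::cstar_algebra))"
  by (induction I rule: infinite_finite_induct) (simp_all add: star_add)

text \<open>If \<open>e\<close> is an approximate unit for the whole orbit of F, each translate is
  one for F: \<open>\<alpha> g e * a - a\<close> is the image under \<open>\<alpha> g\<close> of
  \<open>e * b - b\<close>, where b is the translate of a by the inverse of g. The mean over the
  group inherits the estimate.\<close>

lemma invariant_approximate_unit:
  fixes G :: "('g, 'b) monoid_scheme" and \<alpha> :: "'g \<Rightarrow> 'a::cstar_algebra \<Rightarrow> 'a"
  assumes "group G" and fin: "finite (carrier G)" and hom: "\<alpha> \<in> hom G Aut"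
    and F: "finite F" and \<epsilon>: "\<epsilon> > 0"
  obtains e where "star e = e" "norm e \<le> 1" "\<And>a. a \<in> F \<Longrightarrow> norm (e * a - a) < \<epsilon>"
    "\<And>g. g \<in> carrier G \<Longrightarrow> \<alpha> g e = e"
proof -
  interpret G: group G by fact
  interpret \<alpha>: group_hom G Aut \<alpha>
    by (simp add: group_hom_def group_hom_axioms_def group_Aut hom G.is_group)
  note \<alpha>.hom_mult [simp del] \<alpha>.hom_inv [simp del]
  define N where "N = real (card (carrier G))"
  have N: "N > 0" using fin G.one_closed by (auto simp: N_def card_gt_0_iff)
  have aut: "star_automorphism (\<alpha> g)" if "g \<in> carrier G" for g
    using \<alpha>.hom_closed[OF that] by (simp add: Aut_def)
  note lin = star_automorphism_linear[OF aut]
  have comp: "\<alpha> (g \<otimes>\<^bsub>G\<^esub> h) x = \<alpha> g (\<alpha> h x)" if "g \<in> carrier G" "h \<in> carrier G" for g h x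
    using \<alpha>.hom_mult[OF that] by (simp add: Aut_def)
  have cancel: "\<alpha> g (\<alpha> (inv\<^bsub>G\<^esub> g) x) = x" if "g \<in> carrier G" for g x
    using \<alpha>.hom_one that comp[of g "inv\<^bsub>G\<^esub> g" x] by (simp add: Aut_def)
  have "finite ((\<lambda>(g, a). \<alpha> g a) ` (carrier G \<times> F))" using fin F by simp
  from approximate_unit[OF this \<epsilon>] obtain e where e: "star e = e" "norm e \<le> 1"
    "\<And>g a. g \<in> carrier G \<Longrightarrow> a \<in> F \<Longrightarrow> norm (e * \<alpha> g a - \<alpha> g a) < \<epsilon>"
    by (metis (mono_tags, lifting) SigmaI case_prod_conv image_eqI)
  define E where "E = (1 / N) *\<^sub>R (\<Sum>g\<in>carrier G. \<alpha> g e)"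
  show thesis
  proof
    have "star (\<alpha> g e) = \<alpha> g e" if "g \<in> carrier G" for g
      using aut[OF that] e(1) unfolding star_automorphism_def by metis
    then show "star E = E"
      by (simp add: E_def star_scaleR star_sum)
    have "norm (\<alpha> g e) \<le> 1" if "g \<in> carrier G" for g
      using star_automorphism_norm_le[OF aut[OF that], of e] e(2) by simp
    then have "norm (\<Sum>g\<in>carrier G. \<alpha> g e) \<le> N"
      using sum_norm_le[of "carrier G" "\<lambda>g. \<alpha> g e" "\<lambda>_. 1"] by (simp add: N_def)
    then show "norm E \<le> 1" using N by (simp add: E_def)
  next
    fix g assume g: "g \<in> carrier G"
    have "\<alpha> g E = (1 / N) *\<^sub>R (\<Sum>h\<in>carrier G. \<alpha> (g \<otimes>\<^bsub>G\<^esub> h) e)"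
      using g by (simp add: E_def linear_scale[OF lin] linear_sum[OF lin] comp)
    \<comment> \<open>Left translation by \<open>g\<close> permutes the group.\<close>
    also have "(\<Sum>h\<in>carrier G. \<alpha> (g \<otimes>\<^bsub>G\<^esub> h) e) = (\<Sum>h\<in>carrier G. \<alpha> h e)"
      by (rule sum.reindex_bij_witness[where i="\<lambda>h. inv\<^bsub>G\<^esub> g \<otimes>\<^bsub>G\<^esub> h" and j="\<lambda>h. g \<otimes>\<^bsub>G\<^esub> h"])
        (use g in \<open>simp_all flip: G.m_assoc\<close>)
    finally show "\<alpha> g E = E" by (simp add: E_def)
  next
    fix a assume a: "a \<in> F"
    have "norm (\<alpha> g e * a - a) < \<epsilon>" if g: "g \<in> carrier G" for g
    proof -
      let ?b = "\<alpha> (inv\<^bsub>G\<^esub> g) a"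
      have "\<alpha> g (e * ?b - ?b) = \<alpha> g e * a - a"
        using aut[OF g] by (simp add: linear_diff[OF lin[OF g]] star_automorphism_def cancel g)
      moreover have "norm (e * ?b - ?b) < \<epsilon>" using e(3) a g by simp
      ultimately show ?thesis
        using star_automorphism_norm_le[OF aut[OF g], of "e * ?b - ?b"] by simp
    qed
    then have "(\<Sum>g\<in>carrier G. norm (\<alpha> g e * a - a)) < (\<Sum>g\<in>carrier G. \<epsilon>)"
      using fin G.one_closed by (intro sum_strict_mono) auto
    then have "norm (\<Sum>g\<in>carrier G. \<alpha> g e * a - a) < N * \<epsilon>"
      using norm_sum[of "\<lambda>g. \<alpha> g e * a - a" "carrier G"] by (simp add: N_def)
    moreover have "E * a - a = (1 / N) *\<^sub>R (\<Sum>g\<in>carrier G. \<alpha> g e * a - a)"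
      using N by (simp add: E_def sum_subtractf sum_distrib_right scaleR_diff_right N_def
          sum_constant_scaleR)
    ultimately show "norm (E * a - a) < \<epsilon>"
      using N by (simp add: field_simps)
  qed
qed

section \<open>The Rokhlin elements\<close>

lemma norm_sandwich_le:
  fixes p q x :: "'a::real_normed_algebra"
  assumes "norm p \<le> 1" "norm q \<le> 1"
  shows "norm (p * x * q) \<le> norm x"
  using norm_mult_le_left[OF assms(2), of "p * x"] norm_mult_le_right[OF assms(1), of x] by simp

lemma norm_sandwich_diff_le:
  fixes p q x :: "'a::real_normed_algebra"
  assumes "norm p \<le> 1" "norm q \<le> 1" "norm x \<le> 1"
  shows "norm (p * x * p - q * x * q) \<le> 2 * norm (p - q)"
proof -
  have "p * x * p - q * x * q = (p - q) * (x * p) + (q * x) * (p - q)"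
    by (simp add: algebra_simps)
  moreover have "norm ((p - q) * (x * p)) \<le> norm (p - q)"
    and "norm ((q * x) * (p - q)) \<le> norm (p - q)"
    using assms by (simp_all add: norm_mult_le_left norm_mult_le_right norm_mult_le_one)
  ultimately show ?thesis
    using norm_triangle_ineq[of "(p - q) * (x * p)" "(q * x) * (p - q)"] by simp
qed

text \<open>Moving \<open>p\<close> past \<open>a\<close> on either side costs one commutator each
  and leaves the compression of \<open>x * a - a * x\<close>; inserting \<open>a\<close> splits this
  into two approximate-unit errors.\<close>

lemma norm_sandwich_commutator_le:
  fixes p x a :: "'a::real_normed_algebra"
  assumes "norm p \<le> 1" "norm x \<le> 1"
  shows "norm (p * x * p * a - a * (p * x * p))
    \<le> 2 * norm (p * a - a * p) + norm (x * a - a) + norm (a * x - a)"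
proof -
  have "p * x * p * a - a * (p * x * p) =
      ((p * x) * (p * a - a * p) + (p * a - a * p) * (x * p)) +
      (p * (x * a - a) * p - p * (a * x - a) * p)"
    by (simp add: algebra_simps)
  moreover have "norm ((p * x) * (p * a - a * p)) \<le> norm (p * a - a * p)"
    and "norm ((p * a - a * p) * (x * p)) \<le> norm (p * a - a * p)"
    using assms by (simp_all add: norm_mult_le_left norm_mult_le_right norm_mult_le_one)
  moreover have "norm (p * (x * a - a) * p) \<le> norm (x * a - a)"
    and "norm (p * (a * x - a) * p) \<le> norm (a * x - a)"
    using assms by (simp_all add: norm_sandwich_le)
  ultimately show ?thesis
    by (smt (verit) norm_triangle_ineq norm_triangle_ineq4)
qed

text \<open>Three replacements lead from p x p a through p x a p and p a p to p a; the first and the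
  last cost a commutator, the middle one the approximate-unit error.\<close>

lemma norm_sandwich_unit_le:
  fixes p x a :: "'a::real_normed_algebra"
  assumes "norm p \<le> 1" "norm x \<le> 1" "p * p = p"
  shows "norm (p * x * p * a - p * a) \<le> 2 * norm (p * a - a * p) + norm (x * a - a)"
proof -
  have "p * (p * a) = p * a" using assms(3) by (simp flip: mult.assoc)
  then have "p * x * p * a - p * a =
      (p * x) * (p * a - a * p) + p * (x * a - a) * p - p * (p * a - a * p)"
    by (simp add: algebra_simps)
  moreover have "norm ((p * x) * (p * a - a * p)) \<le> norm (p * a - a * p)"
    and "norm (p * (p * a - a * p)) \<le> norm (p * a - a * p)"
    and "norm (p * (x * a - a) * p) \<le> norm (x * a - a)"
    using assms by (simp_all add: norm_mult_le_right norm_mult_le_one norm_sandwich_le)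
  ultimately show ?thesis
    by (smt (verit) norm_triangle_ineq norm_triangle_ineq4)
qed

lemma norm_square_mult_diff_le:
  fixes e a :: "'a::real_normed_algebra"
  assumes "norm e \<le> 1"
  shows "norm (e * e * a - a) \<le> 2 * norm (e * a - a)"
proof -
  have eq: "e * e * a - a = e * (e * a - a) + (e * a - a)" by (simp add: algebra_simps)
  show ?thesis
    unfolding eq
    using norm_triangle_ineq[of "e * (e * a - a)" "e * a - a"]
      norm_mult_le_right[OF assms, of "e * a - a"] by linarith
qed

theorem corollary3:
  fixes G :: "('g, 'b) monoid_scheme" and \<alpha> :: "'g \<Rightarrow> 'a::cstar_algebra \<Rightarrow> 'a"
  assumes "group G" and "finite (carrier G)" and "\<alpha> \<in> hom G Aut"
    and "multiplier_rokhlin G \<alpha>"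
  shows "rokhlin G \<alpha>"
  unfolding rokhlin_def
proof (intro allI impI, elim conjE)
  fix \<epsilon> :: real and F :: "'a set"
  assume \<epsilon>: "\<epsilon> > 0" and F: "finite F"
  interpret G: group G by fact
  define N where "N = real (card (carrier G))"
  have "carrier G \<noteq> {}" using G.one_closed by blast
  then have "card (carrier G) \<ge> 1" using assms(2) by (simp add: Suc_leI card_gt_0_iff)
  then have N: "N \<ge> 1" by (simp add: N_def)
  \<comment> \<open>The commutator estimate totals 2 + 2 + 2 multiples of \<delta>, and the unit
    estimate 2 + 2 for each of the \<open>N\<close> group elements.\<close>
  define \<delta> where "\<delta> = \<epsilon> / (6 * N)"
  have \<delta>: "\<delta> > 0" "6 * \<delta> \<le> \<epsilon>" "4 * (N * \<delta>) < \<epsilon>"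
    using N \<epsilon> by (simp_all add: \<delta>_def field_simps)
  obtain p :: "'g \<Rightarrow> 'a multiplier" where p:
    "\<And>g. g \<in> carrier G \<Longrightarrow> is_projection (p g)"
    "\<And>g h. g \<in> carrier G \<Longrightarrow> h \<in> carrier G \<Longrightarrow> g \<noteq> h \<Longrightarrow> p g * p h = 0"
    "\<And>g h. g \<in> carrier G \<Longrightarrow> h \<in> carrier G \<Longrightarrow>
      norm (mult_ext (\<alpha> g) (p h) - p (g \<otimes>\<^bsub>G\<^esub> h)) < \<delta>"
    "\<And>g a. g \<in> carrier G \<Longrightarrow> a \<in> F \<Longrightarrow> norm (p g * embed a - embed a * p g) < \<delta>"
    "(\<Sum>g\<in>carrier G. p g) = 1"
    using assms(4)[unfolded multiplier_rokhlin_def, THEN spec, THEN spec, THEN mp, OF conjI,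
      OF F \<delta>(1)]
    by (elim exE conjE) (rule that; simp)
  \<comment> \<open>Adjoints are included so that \<open>e\<close> also approximates a unit for F
    from the right.\<close>
  obtain e where e: "star e = e" "norm e \<le> 1" "\<And>a. a \<in> F \<union> star ` F \<Longrightarrow> norm (e * a - a) < \<delta>"
    "\<And>g. g \<in> carrier G \<Longrightarrow> \<alpha> g e = e"
    using invariant_approximate_unit[OF assms(1-3), of "F \<union> star ` F" \<delta>] F \<delta>(1) by auto
  have aut: "star_automorphism (\<alpha> g)" if "g \<in> carrier G" for g
    using hom_in_carrier[OF assms(3) that] by (simp add: Aut_def)
  \<comment> \<open>The square of \<open>e\<close> makes each compression
    \<open>p g * x * p g\<close> visibly of the form \<open>star y * y\<close>.\<close>
  define x where "x = embed (e * e)"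
  have nx: "norm x \<le> 1" using e(2) by (simp add: x_def norm_mult_le_one)
  have ext: "mult_ext (\<alpha> g) x = x" if "g \<in> carrier G" for g
    using aut[OF that] e(4)[OF that]
    by (simp add: x_def mult_ext_embed star_automorphism_def)
  have xa: "norm (x * embed a - embed a) < 2 * \<delta>" if "a \<in> F" for a
  proof -
    have "norm (e * e * a - a) < 2 * \<delta>"
      using norm_square_mult_diff_le[OF e(2), of a] e(3)[of a] that by simp
    then show ?thesis by (simp add: x_def flip: embed_hom embed_diff)
  qed
  have ax: "norm (embed a * x - embed a) < 2 * \<delta>" if "a \<in> F" for a
  proof -
    have "norm (e * e * star a - star a) < 2 * \<delta>"
      using norm_square_mult_diff_le[OF e(2), of "star a"] e(3)[of "star a"] that by simp
    moreover have "e * e * star a - star a = star (a * (e * e) - a)"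
      by (simp add: star_diff star_mult e)
    ultimately show ?thesis by (simp add: x_def flip: embed_hom embed_diff)
  qed
  note np = norm_projection_le[OF p(1)]
  \<comment> \<open>This is the element of A that embeds as the compression of \<open>x\<close> by
    \<open>p g\<close>; it exists because A is an ideal.\<close>
  define r where "r g = lmul (p g) (rmul (p g) (e * e))" for g
  have r: "embed (r g) = p g * x * p g" for g
    unfolding mult.assoc by (simp only: r_def x_def embed_ideal)
  have "is_positive (r g)" "norm (r g) \<le> 1" if g: "g \<in> carrier G" for g
  proof -
    \<comment> \<open>The witness of positivity is the product of \<open>e\<close> and
      \<open>p g\<close>, again an element of A.\<close>
    have "embed (star (rmul (p g) e) * rmul (p g) e) = embed (r g)"
      using p(1)[OF g]
      by (simp add: r x_def embed_hom e(1) is_projection_def star_mult mult.assoc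
          flip: embed_ideal) (simp add: e(1) flip: embed_hom(4))
    then show "is_positive (r g)" unfolding embed_inject is_positive_def by metis
    show "norm (r g) \<le> 1"
      unfolding norm_embed[symmetric, of "r g"] r
      using norm_sandwich_le[OF np[OF g] np[OF g], of x] nx by simp
  qed
  moreover have "r g * r h = 0" if gh: "g \<in> carrier G" "h \<in> carrier G" "g \<noteq> h" for g h
  proof -
    have "embed (r g * r h) = p g * x * (p g * p h) * x * p h"
      by (simp add: embed_hom r mult.assoc)
    also have "\<dots> = 0" by (simp add: p(2)[OF gh])
    finally show ?thesis by (metis embed_inject embed_zero)
  qed
  moreover have "norm (\<alpha> g (r h) - r (g \<otimes>\<^bsub>G\<^esub> h)) < \<epsilon>"
    if g: "g \<in> carrier G" and h: "h \<in> carrier G" for g h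
  proof -
    \<comment> \<open>The extension fixes \<open>x\<close>, so the image of \<open>r h\<close> is
      the compression of \<open>x\<close> by the projection \<open>?P\<close>, which is close to
      \<open>?p\<close>.\<close>
    let ?P = "mult_ext (\<alpha> g) (p h)" and ?p = "p (g \<otimes>\<^bsub>G\<^esub> h)"
    have "is_projection ?P"
      using p(1)[OF h] unfolding is_projection_def by (metis mult_ext_hom(3,4)[OF aut[OF g]])
    then have nP: "norm ?P \<le> 1" by (rule norm_projection_le)
    have "embed (\<alpha> g (r h) - r (g \<otimes>\<^bsub>G\<^esub> h)) = ?P * x * ?P - ?p * x * ?p"
      by (simp add: embed_diff r mult_ext_hom[OF aut[OF g]] ext[OF g]
          flip: mult_ext_embed[OF aut[OF g]])
    then have "norm (\<alpha> g (r h) - r (g \<otimes>\<^bsub>G\<^esub> h)) \<le> 2 * norm (?P - ?p)"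
      using norm_sandwich_diff_le[OF nP np nx, of "g \<otimes>\<^bsub>G\<^esub> h"] g h by (metis norm_embed G.m_closed)
    with p(3)[OF g h] \<delta> show ?thesis by linarith
  qed
  moreover have "norm (r g * a - a * r g) < \<epsilon>" if a: "a \<in> F" and g: "g \<in> carrier G" for a g
    unfolding norm_embed[symmetric, of "r g * a - a * r g"] embed_diff embed_hom r
    using norm_sandwich_commutator_le[OF np[OF g] nx, of "embed a"] p(4)[OF g a] xa[OF a] ax[OF a] \<delta>
    by linarith
  moreover have "norm ((\<Sum>g\<in>carrier G. r g) * a - a) < \<epsilon>" if a: "a \<in> F" for a
  proof -
    \<comment> \<open>Since the projections sum to 1, a is the sum of the multiples
      \<open>p g * embed a\<close>, and the error can be estimated summand by summand.\<close>
    have "embed ((\<Sum>g\<in>carrier G. r g) * a - a)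
        = (\<Sum>g\<in>carrier G. embed (r g)) * embed a - (\<Sum>g\<in>carrier G. p g) * embed a"
      using sum_comp_morphism[OF embed_zero embed_hom(1), of r "carrier G"]
      by (simp add: embed_diff embed_hom(2) p(5) o_def)
    also have "\<dots> = (\<Sum>g\<in>carrier G. p g * x * p g * embed a - p g * embed a)"
      by (simp add: r sum_distrib_right sum_subtractf)
    finally have "norm ((\<Sum>g\<in>carrier G. r g) * a - a)
        = norm (\<Sum>g\<in>carrier G. p g * x * p g * embed a - p g * embed a)"
      by (metis norm_embed)
    also have "\<dots> \<le> (\<Sum>g\<in>carrier G. 4 * \<delta>)"
    proof (rule sum_norm_le)
      fix g assume g: "g \<in> carrier G"
      then have "p g * p g = p g" using p(1) by (simp add: is_projection_def)
      then show "norm (p g * x * p g * embed a - p g * embed a) \<le> 4 * \<delta>"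
        using norm_sandwich_unit_le[OF np[OF g] nx, of "embed a"] p(4)[OF g a] xa[OF a] by linarith
    qed
    also have "\<dots> < \<epsilon>" using \<delta>(3) by (simp add: N_def mult_ac)
    finally show ?thesis .
  qed
  ultimately show "\<exists>r. (\<forall>g\<in>carrier G. is_positive (r g) \<and> norm (r g) \<le> 1) \<and>
      (\<forall>g\<in>carrier G. \<forall>h\<in>carrier G. g \<noteq> h \<longrightarrow> r g * r h = 0) \<and>
      (\<forall>g\<in>carrier G. \<forall>h\<in>carrier G. norm (\<alpha> g (r h) - r (g \<otimes>\<^bsub>G\<^esub> h)) < \<epsilon>) \<and>
      (\<forall>a\<in>F. \<forall>g\<in>carrier G. norm (r g * a - a * r g) < \<epsilon>) \<and>
      (\<forall>a\<in>F. norm ((\<Sum>g\<in>carrier G. r g) * a - a) < \<epsilon>)"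
    by (intro exI[of _ r]) simp
qed

end
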